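(* Let $k$ be a positive integer, and let $N$ be the maximum possible value of $n$ for which some simple connected graph of edge metric dimension at most $k$ contains the complete bipartite graph $K_{n,n}$ as a subgraph. Then $$2^{\lfloor k/2 \rfloor} \leq N \leq 3^{k/2}.$$
   Context: All graphs are simple and connected. For vertices $u,v$ of a graph $G$, $d(u,v)$ is their distance in $G$. For an edge $e=\{x,y\}$ and a vertex $v$, let $d(e,v)=\min(d(x,v),d(y,v))$. A set $S\subset V(G)$ is a resolving set for the edges of $G$ if no two distinct edges $e,f$ satisfy $d(e,s)=d(f,s)$ for all $s\in S$. The edge metric dimension $\operatorname{edim}(G)$ is the minimum size of a resolving set for the edges of $G$. Subgraphs are not required to be induced. *)

theory Defs
  imports Complex_Main "Graph_Theory.Graph_Theory"
begin

text \<open>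
  Graphs are symmetric digraphs as in \<open>Graph_Theory\<close>: a finite simple graph is a
  \<open>pair_graph\<close>, in which every undirected edge is represented by two opposite arcs.
  All edge-related notions below therefore speak about the unordered pairs of
  end points, so that an edge is not counted once per orientation.
\<close>

definition uedges :: "('a, 'b) pre_digraph \<Rightarrow> 'a set set" where
  "uedges G = {{u, v} | u v. u \<rightarrow>\<^bsub>G\<^esub> v}"

text \<open>The value is \<open>\<infinity>\<close> if there is no walk from \<open>u\<close> to \<open>v\<close>.\<close>

definition vdist :: "('a, 'b) pre_digraph \<Rightarrow> 'a \<Rightarrow> 'a \<Rightarrow> ereal" where
  "vdist G u v = wf_digraph.\<mu> G (\<lambda>_. 1) u v"

definition edist :: "('a, 'b) pre_digraph \<Rightarrow> 'a set \<Rightarrow> 'a \<Rightarrow> ereal" where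
  "edist G e v = Min ((\<lambda>x. vdist G x v) ` e)"

definition edge_resolving :: "('a, 'b) pre_digraph \<Rightarrow> 'a set \<Rightarrow> bool" where
  "edge_resolving G S \<longleftrightarrow> S \<subseteq> verts G \<and>
     \<not> (\<exists>e \<in> uedges G. \<exists>f \<in> uedges G. e \<noteq> f \<and> (\<forall>s \<in> S. edist G e s = edist G f s))"

text \<open>
  In a finite graph the set of all vertices is edge resolving, and all vertex sets are finite,
  so the minimum below exists and \<open>card\<close> is meaningful.
\<close>

definition edim :: "('a, 'b) pre_digraph \<Rightarrow> nat" where
  "edim G = (LEAST m. \<exists>S. edge_resolving G S \<and> card S = m)"

text \<open>
  Every finite graph is isomorphic to one whose vertices are natural numbers, so
  quantifying over the latter covers all finite graphs. The name \<open>connected\<close> is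
  qualified because it is also used for topological connectedness.
\<close>

definition Knn_in_edim_at_most :: "nat \<Rightarrow> nat \<Rightarrow> bool" where
  "Knn_in_edim_at_most k n \<longleftrightarrow>
     (\<exists>G :: nat pair_pre_digraph.
        pair_graph G \<and> Digraph_Component.connected (with_proj G) \<and> edim (with_proj G) \<le> k \<and>
        (\<exists>H :: nat pair_pre_digraph. subgraph (with_proj H) (with_proj G) \<and> K\<^bsub>n,n\<^esub> (with_proj H)))"

end

theory Submission
  imports Defs
begin

text \<open>
  \<^emph>\<open>Upper bound.\<close> Let \<open>U\<close> and \<open>V\<close> be the sides of a \<open>K\<^bsub>n,n\<^esub>\<close> in \<open>G\<close> and let \<open>s\<close> be any vertex. If a
  vertex nearest to \<open>s\<close> among \<open>U \<union> V\<close> has distance \<open>D\<close> and lies, say, in \<open>U\<close>, then every vertex of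
  \<open>V\<close> is adjacent to it and has distance at most \<open>D + 1\<close>. Every edge between \<open>U\<close> and \<open>V\<close>
  has an end point in \<open>V\<close>, so that its distance to \<open>s\<close> is \<open>D\<close> or \<open>D + 1\<close>. Hence a resolving set of \<open>m\<close>
  vertices tells apart at most \<open>2 ^ m\<close> of these \<open>n\<^sup>2\<close> edges, which gives \<open>n\<^sup>2 \<le> 2 ^ k\<close>
  (\<open>pair_graph.complete_bipartite_le_resolving\<close>). This is more than the required
  \<open>n \<le> 3 powr (k / 2)\<close>.

  \<^emph>\<open>Lower bound.\<close> Put \<open>j = k div 2\<close> and label each side of \<open>K\<^bsub>n,n\<^esub>\<close>, \<open>n = 2 ^ j\<close>, by the binary
  words of length \<open>j\<close>. For each side and each \<open>i < j\<close> add a probe, adjacent to those vertices of that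
  side whose label has bit \<open>i\<close> set. The \<open>2 * j\<close> probes form a resolving set, and it is enough to know
  for each probe whether its distance to an edge is \<open>0\<close>, \<open>1\<close> or larger: the probes at distance \<open>0\<close>
  are those on the edge, and those at distance at most \<open>1\<close> spell out the labels of
  the end points in \<open>K\<^bsub>n,n\<^esub>\<close> (\<open>bit_graph_resolving\<close>).
\<close>

section \<open>Distances as lengths of walks\<close>

context fin_digraph
begin

lemma awalk_cost_unit: "awalk_cost (\<lambda>_. 1) p = real (length p)"
  by (induction p) auto

lemma vdist_walk_or_infinity:
  "vdist G u v = \<infinity> \<or> (\<exists>p. awalk u p v \<and> vdist G u v = ereal (real (length p)))"
proof (cases "u \<rightarrow>\<^sup>* v")
  case True
  then obtain p where "apath u p v" "\<mu> (\<lambda>_. 1) u v = awalk_cost (\<lambda>_. 1) p"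
    using min_cost_awalk[of u v "\<lambda>_. 1"] by auto
  then show ?thesis
    by (auto simp: vdist_def awalk_cost_unit dest: awalkI_apath)
next
  case False
  then show ?thesis
    by (simp add: vdist_def shortest_path_inf)
qed

lemma vdist_le_iff_walk:
  "vdist G u v \<le> ereal (real n) \<longleftrightarrow> (\<exists>p. awalk u p v \<and> length p \<le> n)"
proof
  assume "vdist G u v \<le> ereal (real n)"
  then show "\<exists>p. awalk u p v \<and> length p \<le> n"
    using vdist_walk_or_infinity[of u v] by auto
next
  assume "\<exists>p. awalk u p v \<and> length p \<le> n"
  then obtain p where p: "awalk u p v" "length p \<le> n" by blast
  have "vdist G u v \<le> ereal (real (length p))"
    using min_cost_le_walk_cost[OF p(1), of "\<lambda>_. 1"] by (simp add: vdist_def awalk_cost_unit)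
  also have "\<dots> \<le> ereal (real n)" using p(2) by simp
  finally show "vdist G u v \<le> ereal (real n)" .
qed

lemma vdist_adj_le:
  assumes "u \<rightarrow>\<^bsub>G\<^esub> v"
  shows "vdist G u w \<le> vdist G v w + 1"
proof (cases "vdist G v w = \<infinity>")
  case False
  then obtain p where p: "awalk v p w" "vdist G v w = ereal (real (length p))"
    using vdist_walk_or_infinity by blast
  obtain a where "a \<in> arcs G" "tail G a = u" "head G a = v"
    using assms by auto
  with p(1) have "awalk u (a # p) w" by (simp add: awalk_Cons_iff)
  then have "vdist G u w \<le> ereal (real (Suc (length p)))"
    unfolding vdist_le_iff_walk by (intro exI[of _ "a # p"]) simp
  with p(2) show ?thesis by (simp add: add.commute)
qed simp

lemma vdist_le_0_iff: "vdist G u v \<le> 0 \<longleftrightarrow> u = v \<and> u \<in> verts G"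
  using vdist_le_iff_walk[of u v 0] by (auto simp: awalk_Nil_iff zero_ereal_def)

lemma vdist_le_1_iff: "vdist G u v \<le> 1 \<longleftrightarrow> u = v \<and> u \<in> verts G \<or> u \<rightarrow>\<^bsub>G\<^esub> v"
proof -
  have "(\<exists>p. awalk u p v \<and> length p \<le> 1) \<longleftrightarrow> awalk u [] v \<or> (\<exists>a. awalk u [a] v)"
    by (force simp: le_Suc_eq length_Suc_conv)
  moreover have adj: "(\<exists>a. awalk u [a] v) \<longleftrightarrow> u \<rightarrow>\<^bsub>G\<^esub> v"
    by (auto simp: awalk_simps arcs_ends_conv image_iff)
  ultimately show ?thesis
    using vdist_le_iff_walk[of u v 1]
    by (simp add: awalk_Nil_iff adj one_ereal_def)
qed

end

lemma edist_edge: "edist G {x, y} s = min (vdist G x s) (vdist G y s)"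
  by (simp add: edist_def)

lemma edge_resolvingD:
  assumes "edge_resolving G S" "e \<in> uedges G" "f \<in> uedges G"
    and "\<And>s. s \<in> S \<Longrightarrow> edist G e s = edist G f s"
  shows "e = f"
  using assms unfolding edge_resolving_def by metis

context pair_graph
begin

lemma edge_in_verts: "e \<in> uedges G \<Longrightarrow> e \<subseteq> pverts G"
  by (auto simp: uedges_def in_arcsD1 in_arcsD2)

lemma edist_le_iff:
  assumes "e \<in> uedges G"
  shows "edist G e s \<le> c \<longleftrightarrow> (\<exists>x\<in>e. vdist G x s \<le> c)"
  using assms by (auto simp: uedges_def edist_edge min_le_iff_disj)

lemma edist_le_0_iff: "e \<in> uedges G \<Longrightarrow> edist G e s \<le> 0 \<longleftrightarrow> s \<in> e"
  using edge_in_verts by (auto simp: edist_le_iff vdist_le_0_iff)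

lemma edist_le_1_iff:
  "e \<in> uedges G \<Longrightarrow> edist G e s \<le> 1 \<longleftrightarrow> s \<in> e \<or> (\<exists>x\<in>e. (x, s) \<in> parcs G)"
  using edge_in_verts by (auto simp: edist_le_iff vdist_le_1_iff)

text \<open>An edge consists of the vertices at distance \<open>0\<close> from it.\<close>

lemma edge_resolving_pverts: "edge_resolving G (pverts G)"
proof -
  have "e = f" if "e \<in> uedges G" "f \<in> uedges G" "\<forall>s\<in>pverts G. edist G e s = edist G f s" for e f
  proof -
    have "s \<in> e \<longleftrightarrow> s \<in> f" if "s \<in> pverts G" for s
      using that \<open>\<forall>s\<in>pverts G. edist G e s = edist G f s\<close>
        edist_le_0_iff[OF \<open>e \<in> uedges G\<close>, of s] edist_le_0_iff[OF \<open>f \<in> uedges G\<close>, of s] by simp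
    then show "e = f"
      using edge_in_verts \<open>e \<in> uedges G\<close> \<open>f \<in> uedges G\<close> by blast
  qed
  then show ?thesis
    by (auto simp: edge_resolving_def)
qed

lemma edim_le_iff: "edim G \<le> k \<longleftrightarrow> (\<exists>S. edge_resolving G S \<and> card S \<le> k)"
proof
  have "\<exists>S. edge_resolving G S \<and> card S = edim G"
    unfolding edim_def by (rule LeastI_ex) (use edge_resolving_pverts in blast)
  then show "edim G \<le> k \<Longrightarrow> \<exists>S. edge_resolving G S \<and> card S \<le> k"
    by auto
next
  assume "\<exists>S. edge_resolving G S \<and> card S \<le> k"
  then obtain S where "edge_resolving G S" "card S \<le> k" by blast
  moreover from this(1) have "edim G \<le> card S"
    unfolding edim_def by (intro Least_le) blast
  ultimately show "edim G \<le> k"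
    by simp
qed

section \<open>A vertex takes two distances to the edges of a complete bipartite subgraph\<close>

text \<open>
  The nearest vertex \<open>w\<close> is adjacent to the end of the edge that lies on the other side, so the
  edge is at most \<open>1\<close> farther away than \<open>w\<close>. Distances are natural numbers or infinite, which
  excludes values strictly in between.
\<close>

lemma edist_two_values:
  assumes arcs: "U \<times> V \<subseteq> parcs G"
    and u: "u \<in> U" and v: "v \<in> V"
    and w: "w \<in> U \<union> V" and nearest: "\<And>x. x \<in> U \<union> V \<Longrightarrow> vdist G w s \<le> vdist G x s"
  shows "edist G {u, v} s \<in> {vdist G w s, vdist G w s + 1}"
proof -
  have "vdist G v s \<le> vdist G w s + 1" if "w \<in> U"
    using vdist_adj_le[of v w s] arcs_symmetric arcs that v by blast
  moreover have "vdist G u s \<le> vdist G w s + 1" if "w \<in> V"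
    using vdist_adj_le[of u w s] arcs that u by blast
  ultimately have upper: "edist G {u, v} s \<le> vdist G w s + 1"
    using w by (auto simp: edist_edge min_le_iff_disj)
  have lower: "vdist G w s \<le> edist G {u, v} s"
    using nearest u v by (simp add: edist_edge)
  have integral: "vdist G x s = \<infinity> \<or> (\<exists>m::nat. vdist G x s = ereal (real m))" for x
    using vdist_walk_or_infinity[of x s] by blast
  have "edist G {u, v} s = \<infinity> \<or> (\<exists>m::nat. edist G {u, v} s = ereal (real m))"
    using integral[of u] integral[of v] by (auto simp: edist_edge min_def)
  with integral[of w] upper lower show ?thesis
    by (auto simp: one_ereal_def)
qed

text \<open>
  The edges of the complete bipartite subgraph have different distance vectors, and each
  coordinate of such a vector has two possible values.
\<close>

lemma complete_bipartite_le_resolving: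
  assumes arcs: "U \<times> V \<subseteq> parcs G" and disjoint: "U \<inter> V = {}"
    and res: "edge_resolving G S"
  shows "card U * card V \<le> 2 ^ card S"
proof -
  define D where "D s = Min ((\<lambda>x. vdist G x s) ` (U \<union> V))" for s
  define signature where "signature = (\<lambda>(u, v). \<lambda>s\<in>S. edist G {u, v} s)"
  have finS: "finite S"
    using res by (auto simp: edge_resolving_def intro: finite_subset[OF _ pair_finite_verts])
  have "inj_on signature (U \<times> V)"
  proof (rule inj_onI)
    fix p q assume "p \<in> U \<times> V" "q \<in> U \<times> V" and sig: "signature p = signature q"
    then obtain u v u' v' where pq: "p = (u, v)" "q = (u', v')"
      and mem: "u \<in> U" "v \<in> V" "u' \<in> U" "v' \<in> V" by blast
    have "\<forall>s\<in>S. edist G {u, v} s = edist G {u', v'} s"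
    proof
      fix s assume "s \<in> S"
      with fun_cong[OF sig, of s] show "edist G {u, v} s = edist G {u', v'} s"
        by (simp add: pq signature_def)
    qed
    moreover have "{u, v} \<in> uedges G" "{u', v'} \<in> uedges G"
      using mem arcs by (auto simp: uedges_def)
    ultimately have "{u, v} = {u', v'}"
      by (intro edge_resolvingD[OF res]) auto
    then show "p = q"
      using mem disjoint by (auto simp: pq doubleton_eq_iff)
  qed
  moreover have "signature ` (U \<times> V) \<subseteq> (\<Pi>\<^sub>E s\<in>S. {D s, D s + 1})"
  proof clarify
    fix u v assume uv: "u \<in> U" "v \<in> V"
    have "finite (U \<union> V)"
    proof (rule finite_subset[OF _ pair_finite_verts])
      show "U \<union> V \<subseteq> pverts G"
        using arcs uv in_arcsD1 in_arcsD2 by blast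
    qed
    have "edist G {u, v} s \<in> {D s, D s + 1}" for s
    proof -
      have "D s \<in> (\<lambda>x. vdist G x s) ` (U \<union> V)"
        unfolding D_def using \<open>finite (U \<union> V)\<close> uv by (intro Min_in) auto
      then obtain w where w: "w \<in> U \<union> V" "D s = vdist G w s" by blast
      have "vdist G w s \<le> vdist G x s" if "x \<in> U \<union> V" for x
        using that \<open>finite (U \<union> V)\<close> unfolding w(2)[symmetric] D_def by simp
      with edist_two_values[OF arcs uv w(1)] show ?thesis
        unfolding w(2) by blast
    qed
    then show "signature (u, v) \<in> (\<Pi>\<^sub>E s\<in>S. {D s, D s + 1})"
      by (auto simp: signature_def)
  qed
  ultimately have "card (U \<times> V) \<le> card (\<Pi>\<^sub>E s\<in>S. {D s, D s + 1})"
    using finS by (intro card_inj_on_le finite_PiE) auto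
  also have "\<dots> = (\<Prod>s\<in>S. card {D s, D s + 1})"
    using finS by (rule card_PiE)
  also have "\<dots> \<le> (\<Prod>s\<in>S. 2)"
    by (intro prod_mono) (auto simp: card_insert_if)
  finally show ?thesis
    by (simp add: card_cartesian_product)
qed

end

theorem Knn_in_edim_at_most_square_le:
  assumes "Knn_in_edim_at_most k n"
  shows "n\<^sup>2 \<le> 2 ^ k"
proof -
  obtain G H :: "nat pair_pre_digraph" where "pair_graph G" and edim: "edim (with_proj G) \<le> k"
    and H: "subgraph (with_proj H) (with_proj G)" "K\<^bsub>n,n\<^esub> (with_proj H)"
    using assms unfolding Knn_in_edim_at_most_def by blast
  interpret pair_graph G by fact
  obtain U V where UV: "U \<inter> V = {}" "card U = n" "card V = n" "parcs H = U \<times> V \<union> V \<times> U"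
    using H(2) unfolding complete_bipartite_digraph_pair_def by blast
  have "U \<times> V \<subseteq> parcs G"
    using H(1) UV(4) by (auto simp: subgraph_def)
  moreover obtain S where S: "edge_resolving G S" "card S \<le> k"
    using edim edim_le_iff by blast
  ultimately have "n\<^sup>2 \<le> 2 ^ card S"
    using complete_bipartite_le_resolving[of U V S] UV by (simp add: power2_eq_square)
  also have "\<dots> \<le> (2::nat) ^ k"
    using S(2) by simp
  finally show ?thesis .
qed

section \<open>Complete bipartite graphs resolved by bit probes\<close>

text \<open>
  The constructors keep the kinds of vertices apart, and \<open>to_nat\<close> turns them into natural numbers.
  The Boolean names the side. \<open>Core b x\<close> is the vertex with label \<open>x\<close> on side \<open>b\<close> of the complete
  bipartite graph, and \<open>Probe b i\<close> asks for bit \<open>i\<close> of the labels on side \<open>b\<close>.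
\<close>

datatype vertex = Core bool nat | Probe bool nat

instance vertex :: countable
  by countable_datatype

abbreviation core :: "bool \<Rightarrow> nat \<Rightarrow> nat" where
  "core b x \<equiv> to_nat (Core b x)"

abbreviation probe :: "bool \<Rightarrow> nat \<Rightarrow> nat" where
  "probe b i \<equiv> to_nat (Probe b i)"

definition oriented_arcs :: "nat \<Rightarrow> nat rel" where
  "oriented_arcs j =
     {(core False x, core True y) | x y. x < 2 ^ j \<and> y < 2 ^ j} \<union>
     {(core b x, probe b i) | b x i. x < 2 ^ j \<and> i < j \<and> bit x i}"

definition core_verts :: "nat \<Rightarrow> bool \<Rightarrow> nat set" where
  "core_verts j b = core b ` {..<2 ^ j}"

definition probes :: "nat \<Rightarrow> nat set" where
  "probes j = (\<lambda>(b, i). probe b i) ` (UNIV \<times> {..<j})"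

definition bit_graph :: "nat \<Rightarrow> nat pair_pre_digraph" where
  "bit_graph j =
     \<lparr>pverts = core_verts j False \<union> core_verts j True \<union> probes j,
      parcs = oriented_arcs j \<union> (oriented_arcs j)\<inverse>\<rparr>"

lemma core_in_bit_graph [simp]: "core b x \<in> pverts (bit_graph j) \<longleftrightarrow> x < 2 ^ j"
  by (cases b) (auto simp: bit_graph_def core_verts_def probes_def)

lemma probe_in_bit_graph [simp]: "probe b i \<in> pverts (bit_graph j) \<longleftrightarrow> i < j"
  by (auto simp: bit_graph_def core_verts_def probes_def image_iff)

lemma nat_eq_if_bits_eq:
  fixes x y :: nat
  assumes "x < 2 ^ j" "y < 2 ^ j" "\<And>i. i < j \<Longrightarrow> bit x i \<longleftrightarrow> bit y i"
  shows "x = y"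
proof -
  have "take_bit j x = take_bit j y"
    using assms(3) by (intro bit_eqI) (auto simp: bit_take_bit_iff)
  then show ?thesis
    using assms(1,2) by (simp add: take_bit_nat_eq_self)
qed

lemma pair_graph_bit_graph: "pair_graph (bit_graph j)"
proof -
  have parcs: "parcs (bit_graph j) = oriented_arcs j \<union> (oriented_arcs j)\<inverse>"
    by (simp add: bit_graph_def)
  have "oriented_arcs j \<subseteq> pverts (bit_graph j) \<times> pverts (bit_graph j)"
    by (auto simp: oriented_arcs_def)
  then have verts: "parcs (bit_graph j) \<subseteq> pverts (bit_graph j) \<times> pverts (bit_graph j)"
    unfolding parcs by blast
  have fin: "finite (pverts (bit_graph j))"
    by (simp add: bit_graph_def core_verts_def probes_def)
  have "finite (parcs (bit_graph j))"
    using verts fin by (meson finite_SigmaI finite_subset)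
  moreover have "symmetric (bit_graph j)"
    by (auto simp: parcs symmetric_def sym_def)
  moreover have "fst a \<noteq> snd a" if "a \<in> parcs (bit_graph j)" for a
    using that by (auto simp: parcs oriented_arcs_def)
  ultimately show ?thesis
    using verts fin by unfold_locales auto
qed

lemma connected_bit_graph: "Digraph_Component.connected (with_proj (bit_graph j))"
proof -
  interpret pair_graph "bit_graph j" by (rule pair_graph_bit_graph)
  let ?hub = "core False 0"
  have core_adj: "(core False x, core True y) \<in> parcs (bit_graph j)" if "x < 2 ^ j" "y < 2 ^ j" for x y
    using that by (auto simp: bit_graph_def oriented_arcs_def)
  have nonempty: "pverts (bit_graph j) \<noteq> {}"
    by (auto simp: bit_graph_def core_verts_def lessThan_empty_iff)
  have right: "?hub \<rightarrow>\<^sup>*\<^bsub>bit_graph j\<^esub> core True y" if "y < 2 ^ j" for y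
    using core_adj[of 0 y] that by auto
  have left: "?hub \<rightarrow>\<^sup>*\<^bsub>bit_graph j\<^esub> core False x" if "x < 2 ^ j" for x
    using reachable_adj_trans[OF right[of 0]] arcs_symmetric[OF core_adj[OF that, of 0]] by simp
  have probe: "?hub \<rightarrow>\<^sup>*\<^bsub>bit_graph j\<^esub> probe b i" if "i < j" for b i
  proof -
    \<comment> \<open>The all-ones label, so that every probe of this side is a neighbour.\<close>
    have "(core b (mask j), probe b i) \<in> parcs (bit_graph j)"
      using that by (auto simp: bit_graph_def oriented_arcs_def bit_mask_iff mask_nat_less_exp)
    moreover have "?hub \<rightarrow>\<^sup>*\<^bsub>bit_graph j\<^esub> core b (mask j)"
      by (cases b) (simp_all add: left right mask_nat_less_exp)
    ultimately show ?thesis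
      by (simp add: reachable_adj_trans)
  qed
  have reach: "?hub \<rightarrow>\<^sup>*\<^bsub>bit_graph j\<^esub> v" if "v \<in> pverts (bit_graph j)" for v
    using that left right probe by (auto simp: bit_graph_def core_verts_def probes_def)
  have "u \<rightarrow>\<^sup>*\<^bsub>bit_graph j\<^esub> v" if "u \<in> pverts (bit_graph j)" "v \<in> pverts (bit_graph j)" for u v
    by (rule reachable_trans[OF symmetric_reachable'[OF reach[OF that(1)]] reach[OF that(2)]])
  then show ?thesis
    unfolding Digraph_Component.connected_def strongly_connected_def
    using nonempty by (auto simp: reachable_mk_symmetric_eq[OF pair_sym_arcs])
qed

lemma card_probes: "card (probes j) = 2 * j"
proof -
  have "inj_on (\<lambda>(b, i). probe b i) (UNIV \<times> {..<j})"
    by (auto simp: inj_on_def)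
  then show ?thesis
    unfolding probes_def by (simp add: card_image card_cartesian_product)
qed

lemma bit_graph_edge_cases:
  assumes "e \<in> uedges (bit_graph j)"
  obtains x y where "x < 2 ^ j" "y < 2 ^ j" "e = {core False x, core True y}"
  | b x i where "x < 2 ^ j" "i < j" "bit x i" "e = {core b x, probe b i}"
proof -
  obtain u v where "(u, v) \<in> oriented_arcs j" "e = {u, v}"
    using assms by (auto simp: uedges_def bit_graph_def)
  then show ?thesis
    using that by (auto simp: oriented_arcs_def)
qed

text \<open>
  The probe on an edge \<open>{core b x, probe b i}\<close> is itself one of those at distance at most \<open>1\<close>,
  which is right because bit \<open>i\<close> of \<open>x\<close> is set. So these probes give the full
  label \<open>x\<close> for both kinds of edges, and the kind is seen from the probes at distance \<open>0\<close>.
\<close>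

lemma bit_graph_resolving: "edge_resolving (bit_graph j) (probes j)"
proof -
  interpret pair_graph "bit_graph j" by (rule pair_graph_bit_graph)
  define near where "near e s \<longleftrightarrow> s \<in> e \<or> (\<exists>x\<in>e. (x, s) \<in> parcs (bit_graph j))" for e s
  have near_core: "near {core False x, core True y} (probe b i) \<longleftrightarrow> bit (if b then y else x) i"
    if "x < 2 ^ j" "y < 2 ^ j" "i < j" for x y b i
    using that by (auto simp: near_def bit_graph_def oriented_arcs_def)
  have near_probe: "near {core b x, probe b i} (probe c l) \<longleftrightarrow> b = c \<and> bit x l"
    if "x < 2 ^ j" "bit x i" "l < j" for x b i c l
    using that by (auto simp: near_def bit_graph_def oriented_arcs_def)
  have "e = f" if e: "e \<in> uedges (bit_graph j)" and f: "f \<in> uedges (bit_graph j)"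
    and same: "\<forall>s\<in>probes j. edist (bit_graph j) e s = edist (bit_graph j) f s" for e f
  proof -
    have probes: "probe b i \<in> probes j" if "i < j" for b i
      using that by (auto simp: probes_def)
    have on: "probe b i \<in> e \<longleftrightarrow> probe b i \<in> f" if "i < j" for b i
      using same probes[OF that] edist_le_0_iff[OF e] edist_le_0_iff[OF f] by metis
    have near: "near e (probe b i) \<longleftrightarrow> near f (probe b i)" if "i < j" for b i
      using same probes[OF that] edist_le_1_iff[OF e] edist_le_1_iff[OF f]
      unfolding near_def by metis
    show ?thesis
    proof (cases rule: bit_graph_edge_cases[OF e])
      case e_core: (1 x y)
      show ?thesis
      proof (cases rule: bit_graph_edge_cases[OF f])
        case f_core: (1 x' y')
        have bits: "bit (if b then y else x) i \<longleftrightarrow> bit (if b then y' else x') i" if "i < j" for b i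
          using near[OF that, of b] that e_core f_core by (simp add: near_core)
        have "x = x'"
          using e_core f_core bits[of _ False] by (intro nat_eq_if_bits_eq) auto
        moreover have "y = y'"
          using e_core f_core bits[of _ True] by (intro nat_eq_if_bits_eq) auto
        ultimately show ?thesis using e_core f_core by simp
      next
        case (2 c x' l)
        with on[of l c] e_core show ?thesis by simp
      qed
    next
      case e_probe: (2 b x i)
      show ?thesis
      proof (cases rule: bit_graph_edge_cases[OF f])
        case (1 x' y')
        with on[of i b] e_probe show ?thesis by simp
      next
        case f_probe: (2 c x' l)
        have same_probe: "c = b" "l = i"
          using on[of i b] e_probe f_probe by simp_all
        have "bit x m \<longleftrightarrow> bit x' m" if "m < j" for m
          using near[OF that, of b] that e_probe f_probe same_probe by (simp add: near_probe)
        then have "x = x'"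
          using e_probe f_probe by (intro nat_eq_if_bits_eq) auto
        then show ?thesis using e_probe f_probe same_probe by simp
      qed
    qed
  qed
  moreover have "probes j \<subseteq> pverts (bit_graph j)"
    by (auto simp: bit_graph_def)
  ultimately show ?thesis
    by (auto simp: edge_resolving_def)
qed

lemma Knn_in_edim_at_most_power:
  assumes "2 * j \<le> k"
  shows "Knn_in_edim_at_most k (2 ^ j)"
proof -
  interpret pair_graph "bit_graph j" by (rule pair_graph_bit_graph)
  let ?U = "core_verts j False" and ?V = "core_verts j True"
  define H where "H = \<lparr>pverts = ?U \<union> ?V, parcs = ?U \<times> ?V \<union> ?V \<times> ?U\<rparr>"
  have "inj_on (core b) {..<2 ^ j}" for b
    by (auto simp: inj_on_def)
  then have "card (core_verts j b) = 2 ^ j" for b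
    unfolding core_verts_def by (simp add: card_image)
  moreover have "?U \<inter> ?V = {}" "finite (?U \<union> ?V)"
    by (auto simp: core_verts_def)
  ultimately have K: "K\<^bsub>2 ^ j,2 ^ j\<^esub> (with_proj H)"
    unfolding complete_bipartite_digraph_pair_def H_def by auto
  have "parcs H \<subseteq> parcs (bit_graph j)"
    by (auto simp: H_def bit_graph_def oriented_arcs_def core_verts_def)
  moreover have "wf_digraph (with_proj H)"
    unfolding wf_digraph_wp_iff by unfold_locales (auto simp: H_def)
  ultimately have "subgraph (with_proj H) (with_proj (bit_graph j))"
    using wf_digraph_axioms by (intro subgraphI) (auto simp: H_def bit_graph_def)
  moreover have "edim (bit_graph j) \<le> k"
    using bit_graph_resolving card_probes assms unfolding edim_le_iff by metis
  ultimately show ?thesis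
    unfolding Knn_in_edim_at_most_def using pair_graph_axioms connected_bit_graph K by blast
qed

section \<open>The bounds on the maximum\<close>

theorem theorem3p5:
  fixes k :: nat
  assumes "k \<ge> 1"
  shows "\<exists>N :: nat.
           (Knn_in_edim_at_most k N \<and> (\<forall>n. Knn_in_edim_at_most k n \<longrightarrow> n \<le> N)) \<and>
           2 ^ (k div 2) \<le> N \<and> real N \<le> 3 powr (real k / 2)"
proof -
  have attained: "Knn_in_edim_at_most k (2 ^ (k div 2))"
    by (rule Knn_in_edim_at_most_power) simp
  have bounded: "n \<le> 2 ^ k" if "Knn_in_edim_at_most k n" for n
    using Knn_in_edim_at_most_square_le[OF that] self_le_power[of n 2] by (cases n) auto
  define N where "N = (GREATEST n. Knn_in_edim_at_most k n)"
  have N: "Knn_in_edim_at_most k N"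
    unfolding N_def using attained bounded by (rule GreatestI_nat)
  have max: "n \<le> N" if "Knn_in_edim_at_most k n" for n
    unfolding N_def using that bounded by (rule Greatest_le_nat)
  have "(real N)\<^sup>2 \<le> 2 ^ k"
    using Knn_in_edim_at_most_square_le[OF N] by (metis of_nat_le_iff of_nat_numeral of_nat_power)
  also have "\<dots> \<le> 3 ^ k"
    by (rule power_mono) auto
  also have "\<dots> = (3 powr (real k / 2))\<^sup>2"
    by (simp add: powr_realpow[symmetric] powr_powr)
  finally have "real N \<le> 3 powr (real k / 2)"
    by (rule power2_le_imp_le) simp
  with N max attained show ?thesis by blast
qed

end
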